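(* For every integer $n>1$, the number of maximal Gallai partitions of the set of edges of the complete graph $K_n$ is equal to the double factorial $(2n-3)!!=1\cdot 3\cdot 5\cdots(2n-3)$.
   Context: $K_n$ is the complete graph on the labeled vertex set $\{1,\dots,n\}$. A Gallai $k$-partition of $K_n$ is a (unordered) partition of its edge set into $k$ nonempty blocks such that every cycle of $K_n$ contains at least two edges belonging to the same block (i.e. there is no rainbow cycle). The maximal possible number of blocks in a Gallai partition of $K_n$ is $n-1$; a Gallai partition is maximal if it has exactly $n-1$ blocks. *)

theory Defs
  imports "HOL-Library.Disjoint_Sets" "HOL-Library.Ramsey"
begin

definition complete_graph_edges :: "nat \<Rightarrow> nat set set" where
  "complete_graph_edges n = [{1..n}]\<^bsup>2\<^esup>"

text \<open>
  A cycle of length at least 3 is given by the list of its vertices in cyclic order,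
  without repeating the first vertex at the end; distinct lists may describe the same cycle.
\<close>

definition cycle_edges :: "'a list \<Rightarrow> 'a set set" where
  "cycle_edges vs = {{vs ! i, vs ! (Suc i mod length vs)} | i. i < length vs}"

definition is_cycle :: "'a set set \<Rightarrow> 'a list \<Rightarrow> bool" where
  "is_cycle E vs \<longleftrightarrow> 3 \<le> length vs \<and> distinct vs \<and> cycle_edges vs \<subseteq> E"

definition gallai_partition :: "nat \<Rightarrow> nat \<Rightarrow> nat set set set \<Rightarrow> bool" where
  "gallai_partition n k P \<longleftrightarrow>
     partition_on (complete_graph_edges n) P \<and> card P = k \<and>
     (\<forall>vs. is_cycle (complete_graph_edges n) vs \<longrightarrow>
        (\<exists>B\<in>P. \<exists>e\<in>cycle_edges vs. \<exists>f\<in>cycle_edges vs. e \<noteq> f \<and> e \<in> B \<and> f \<in> B))"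

definition maximal_gallai_partition :: "nat \<Rightarrow> nat set set set \<Rightarrow> bool" where
  "maximal_gallai_partition n P \<longleftrightarrow> gallai_partition n (n - 1) P"

definition double_factorial :: "nat \<Rightarrow> nat" where
  "double_factorial m = \<Prod>{j \<in> {1..m}. even j \<longleftrightarrow> even m}"

end

theory Submission
  imports Defs "HOL-Computational_Algebra.Formal_Power_Series"
begin

text \<open>
  Deleting a vertex from a complete graph coloured without rainbow triangles loses at most one
  colour, so there are at most \<open>n - 1\<close> colours. When this bound is attained, the vertex set splits
  into two parts such that the edges between them form one whole block, and by counting colours
  the two sides are again extremal and share no colour. Maximal Gallai partitions thus correspond
  to unordered binary trees with labelled leaves. With a root vertex fixed to order the two sides,
  their number \<open>a\<^sub>n\<close> satisfies \<open>a\<^sub>n\<^sub>+\<^sub>1 = (\<Sum>i<n. (n choose i) * a\<^sub>i\<^sub>+\<^sub>1 * a\<^sub>n\<^sub>-\<^sub>i)\<close>, and a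
  generating function argument shows that the double factorials satisfy the same recurrence.
\<close>

section \<open>Edge sets of complete graphs and cuts\<close>

abbreviation edges :: "'a set \<Rightarrow> 'a set set" where
  "edges S \<equiv> [S]\<^bsup>2\<^esup>"

text \<open>For disjoint \<open>A\<close> and \<open>B\<close> this is the edge set of the complete
  bipartite graph between them.\<close>

definition cut :: "'a set \<Rightarrow> 'a set \<Rightarrow> 'a set set" where
  "cut A B = {{a, b} | a b. a \<in> A \<and> b \<in> B}"

lemma doubleton_in_edges_iff [simp]: "{x, y} \<in> edges S \<longleftrightarrow> x \<in> S \<and> y \<in> S \<and> x \<noteq> y"
  by (auto simp: nsets_def card_2_iff doubleton_eq_iff)

lemma edgesE:
  assumes "e \<in> edges S"
  obtains x y where "e = {x, y}" "x \<in> S" "y \<in> S" "x \<noteq> y"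
  using assms by (auto simp: nsets_def card_2_iff)

lemma edges_empty [simp]: "edges {} = {}" and edges_singleton [simp]: "edges {v} = {}"
  by (auto elim!: edgesE)

lemma finite_edges: "finite S \<Longrightarrow> finite (edges S)"
  by (rule finite_imp_finite_nsets)

lemma edges_insert:
  assumes "v \<notin> T"
  shows "edges (insert v T) = edges T \<union> (\<lambda>x. {v, x}) ` T"
proof (intro equalityI subsetI)
  fix e assume "e \<in> edges (insert v T)"
  then obtain x y where "e = {x, y}" "x \<in> insert v T" "y \<in> insert v T" "x \<noteq> y"
    by (rule edgesE)
  then show "e \<in> edges T \<union> (\<lambda>x. {v, x}) ` T"
    using assms by (cases "x = v"; cases "y = v") (auto simp: insert_commute)
next
  fix e assume "e \<in> edges T \<union> (\<lambda>x. {v, x}) ` T"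
  then show "e \<in> edges (insert v T)"
    using assms by (auto elim!: edgesE)
qed

lemma edges_Un: "A \<inter> B = {} \<Longrightarrow> edges (A \<union> B) = cut A B \<union> (edges A \<union> edges B)"
proof (intro equalityI subsetI)
  fix e assume "e \<in> edges (A \<union> B)"
  then obtain x y where "e = {x, y}" "x \<in> A \<union> B" "y \<in> A \<union> B" "x \<noteq> y"
    by (rule edgesE)
  then show "e \<in> cut A B \<union> (edges A \<union> edges B)"
    unfolding cut_def by (auto simp: insert_commute)
next
  fix e assume "A \<inter> B = {}" "e \<in> cut A B \<union> (edges A \<union> edges B)"
  then show "e \<in> edges (A \<union> B)"
    by (auto elim!: edgesE simp: cut_def)
qed

lemma cut_Int_edges:
  assumes "A \<inter> B = {}"
  shows "cut A B \<inter> edges A = {}" "cut A B \<inter> edges B = {}" "edges A \<inter> edges B = {}"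
  using assms by (auto simp: cut_def doubleton_eq_iff elim!: edgesE)

lemma Union_cut: "A \<noteq> {} \<Longrightarrow> B \<noteq> {} \<Longrightarrow> \<Union>(cut A B) = A \<union> B"
  by (auto simp: cut_def)

lemma Union_edges_subset: "\<Union>(edges S) \<subseteq> S"
  by (auto simp: nsets_def)


section \<open>Edge colourings without rainbow triangles\<close>

text \<open>A colouring is a total function on sets, but only its values on two-element subsets of
  \<open>S\<close> matter. Triangles are the only cycles that the structural argument
  inspects.\<close>

definition no_rainbow_triangle :: "('a set \<Rightarrow> 'c) \<Rightarrow> 'a set \<Rightarrow> bool" where
  "no_rainbow_triangle c S \<longleftrightarrow>
     (\<forall>x\<in>S. \<forall>y\<in>S. \<forall>z\<in>S. x \<noteq> y \<longrightarrow> y \<noteq> z \<longrightarrow> x \<noteq> z \<longrightarrow>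
        c {x, y} = c {y, z} \<or> c {y, z} = c {x, z} \<or> c {x, y} = c {x, z})"

lemma no_rainbow_triangleD:
  assumes "no_rainbow_triangle c S" "x \<in> S" "y \<in> S" "z \<in> S" "x \<noteq> y" "y \<noteq> z" "x \<noteq> z"
  shows "c {x, y} = c {y, z} \<or> c {y, z} = c {x, z} \<or> c {x, y} = c {x, z}"
  using assms unfolding no_rainbow_triangle_def by blast

lemma no_rainbow_triangle_subset:
  "no_rainbow_triangle c S \<Longrightarrow> T \<subseteq> S \<Longrightarrow> no_rainbow_triangle c T"
  unfolding no_rainbow_triangle_def by blast

text \<open>Two edges at \<open>v\<close> with distinct colours, both absent from \<open>T\<close>, would span a rainbow triangle.\<close>

lemma colours_insert_subset:
  assumes "no_rainbow_triangle c (insert v T)" "v \<notin> T"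
  obtains p where "c ` edges (insert v T) \<subseteq> insert p (c ` edges T)"
proof (cases "c ` edges (insert v T) \<subseteq> c ` edges T")
  case True
  then show ?thesis using that by blast
next
  case False
  then obtain x where x: "x \<in> T" "c {v, x} \<notin> c ` edges T"
    using edges_insert[OF assms(2)] by auto
  have "c {v, y} \<in> insert (c {v, x}) (c ` edges T)" if y: "y \<in> T" for y
  proof (cases "y = x")
    case False
    then have "{x, y} \<in> edges T" using x y by auto
    then have "c {x, y} \<in> c ` edges T" by blast
    moreover have "v \<noteq> x" "v \<noteq> y" using x y assms(2) by auto
    ultimately show ?thesis
      using no_rainbow_triangleD[OF assms(1), of v x y] x y False by (metis insert_iff)
  qed auto
  then have "c ` edges (insert v T) \<subseteq> insert (c {v, x}) (c ` edges T)"
    using edges_insert[OF assms(2)] by auto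
  then show ?thesis by (rule that)
qed

text \<open>Build up \<open>S\<close> vertex by vertex: the first vertex brings no colour, and by
  \<open>colours_insert_subset\<close> each later one brings at most one.\<close>

lemma card_colours_le:
  assumes "finite S" "no_rainbow_triangle c S"
  shows "card (c ` edges S) \<le> card S - 1"
  using assms
proof (induction S rule: finite_induct)
  case empty
  then show ?case by simp
next
  case (insert v T)
  show ?case
  proof (cases "T = {}")
    case True
    then show ?thesis by simp
  next
    case False
    obtain p where p: "c ` edges (insert v T) \<subseteq> insert p (c ` edges T)"
      using colours_insert_subset insert by metis
    have "card (c ` edges (insert v T)) \<le> card (insert p (c ` edges T))"
      using p insert.hyps by (intro card_mono) (auto simp: finite_edges)
    also have "\<dots> \<le> Suc (card (c ` edges T))"
      by (rule card_insert_le_m1) auto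
    also have "\<dots> \<le> Suc (card T - 1)"
      using insert no_rainbow_triangle_subset[of c "insert v T" T] by auto
    finally show ?thesis using False insert.hyps by (simp add: card_gt_0_iff)
  qed
qed

section \<open>Extremal colourings: equality in the colour bound\<close>

definition tight :: "('a set \<Rightarrow> 'c) \<Rightarrow> 'a set \<Rightarrow> bool" where
  "tight c S \<longleftrightarrow> finite S \<and> no_rainbow_triangle c S \<and> card (c ` edges S) = card S - 1"

text \<open>Deleting \<open>v\<close> loses at most one colour and lowers the bound by exactly one.
  Equality for \<open>insert v T\<close> therefore forces equality for \<open>T\<close> and the loss
  of exactly one colour.\<close>

lemma tight_insert:
  assumes "tight c (insert v T)" "v \<notin> T" "T \<noteq> {}"
  obtains p where "tight c T" "p \<notin> c ` edges T"
    "c ` edges (insert v T) = insert p (c ` edges T)"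
proof -
  have fin: "finite T" and nr: "no_rainbow_triangle c (insert v T)"
    and card: "card (c ` edges (insert v T)) = card T"
    using assms by (auto simp: tight_def)
  have pos: "card T > 0" using fin assms by (simp add: card_gt_0_iff)
  have nrT: "no_rainbow_triangle c T" using nr no_rainbow_triangle_subset by blast
  obtain p where p: "c ` edges (insert v T) \<subseteq> insert p (c ` edges T)"
    using colours_insert_subset nr assms(2) by metis
  have finT: "finite (c ` edges T)" using fin by (simp add: finite_edges)
  have sub: "c ` edges T \<subseteq> c ` edges (insert v T)" using edges_insert[OF assms(2)] by auto
  have le: "card (c ` edges T) \<le> card T - 1" using card_colours_le fin nrT by blast
  have ge: "card T \<le> card (insert p (c ` edges T))"
    using card_mono[OF _ p] card finT by simp
  \<comment> \<open>Otherwise all colours would already occur on \<open>T\<close>, which has at most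
    \<open>card T - 1\<close> of them, one too few.\<close>
  have pnot: "p \<notin> c ` edges T"
  proof
    assume "p \<in> c ` edges T"
    then show False using le ge pos by (simp add: insert_absorb)
  qed
  have eq: "card (c ` edges T) = card T - 1"
    using pnot ge le finT by simp
  have "c ` edges (insert v T) = insert p (c ` edges T)"
    using p card pnot eq finT pos by (intro card_subset_eq) auto
  then show ?thesis using that fin nrT eq pnot by (simp add: tight_def)
qed

text \<open>The two sides have at most \<open>card A - 1\<close> and \<open>card B - 1\<close>
  colours and the cut has one. These bounds add up to exactly \<open>card S - 1\<close>, so each is
  attained and no colour is counted twice.\<close>

lemma tight_cut:
  assumes "tight c S" "S = A \<union> B" "A \<inter> B = {}" "A \<noteq> {}" "B \<noteq> {}"
    and k: "\<And>a b. a \<in> A \<Longrightarrow> b \<in> B \<Longrightarrow> c {a, b} = k"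
  shows "tight c A" "tight c B" "k \<notin> c ` edges A" "k \<notin> c ` edges B"
    "c ` edges A \<inter> c ` edges B = {}"
proof -
  have fin: "finite A" "finite B" and nr: "no_rainbow_triangle c A" "no_rainbow_triangle c B"
    using assms no_rainbow_triangle_subset[of c S] by (auto simp: tight_def)
  let ?CA = "c ` edges A" and ?CB = "c ` edges B"
  have finC: "finite ?CA" "finite ?CB" using fin by (auto simp: finite_edges)
  have pos: "card A > 0" "card B > 0" using fin assms by (auto simp: card_gt_0_iff)
  have le: "card ?CA \<le> card A - 1" "card ?CB \<le> card B - 1"
    using card_colours_le fin nr by blast+
  have "c ` cut A B = {k}" 
  proof -
    obtain a b where "a \<in> A" "b \<in> B" using assms(4,5) by blast
    then have "k \<in> c ` cut A B" using k[of a b] by (force simp: cut_def)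
    moreover have "c ` cut A B \<subseteq> {k}" using k by (auto simp: cut_def)
    ultimately show ?thesis by blast
  qed
  then have "c ` edges S = insert k (?CA \<union> ?CB)"
    unfolding assms(2) edges_Un[OF assms(3)] by (simp add: image_Un)
  then have tot: "card (insert k (?CA \<union> ?CB)) = card A + card B - 1"
    using assms fin by (simp add: tight_def card_Un_disjoint)
  have un: "card (?CA \<union> ?CB) + card (?CA \<inter> ?CB) = card ?CA + card ?CB"
    using card_Un_Int[OF finC] by simp
  have ins: "card (insert k (?CA \<union> ?CB)) \<le> Suc (card (?CA \<union> ?CB))"
    by (rule card_insert_le_m1) auto
  have "k \<notin> ?CA \<union> ?CB"
  proof
    assume "k \<in> ?CA \<union> ?CB"
    then have "card (?CA \<union> ?CB) = card A + card B - 1" using tot by (simp add: insert_absorb)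
    then show False using un le pos by linarith
  qed
  then show "k \<notin> ?CA" "k \<notin> ?CB" by auto
  have "card ?CA = card A - 1" "card ?CB = card B - 1" "card (?CA \<inter> ?CB) = 0"
    using tot un ins le pos by linarith+
  then show "tight c A" "tight c B" "?CA \<inter> ?CB = {}"
    using fin nr finC by (auto simp: tight_def)
qed

text \<open>
  Remove a vertex \<open>v\<close>, split the rest into \<open>A\<close> and \<open>B\<close>, and let \<open>p\<close> be the colour occurring
  only at \<open>v\<close>, say towards \<open>A\<close>. Rainbow-freeness leaves only two options: every edge from \<open>v\<close>
  to \<open>B\<close> has the colour of the cut, so that \<open>v\<close> joins \<open>A\<close>, or all edges at \<open>v\<close> have colour
  \<open>p\<close>, so that \<open>{v}\<close> is split off.
\<close>

lemma tight_step:
  assumes "tight c (insert v (A \<union> B))" "v \<notin> A \<union> B" "A \<inter> B = {}" "A \<noteq> {}" "B \<noteq> {}"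
    and k: "\<And>a b. a \<in> A \<Longrightarrow> b \<in> B \<Longrightarrow> c {a, b} = k"
    and kA: "k \<notin> c ` edges A" and kB: "k \<notin> c ` edges B"
    and x: "x \<in> A" and p: "c {v, x} \<notin> c ` edges (A \<union> B)"
  shows "(\<forall>b\<in>B. c {v, b} = k) \<or> (\<forall>y\<in>A \<union> B. c {v, y} = c {v, x})"
proof -
  have nr: "no_rainbow_triangle c (insert v (A \<union> B))" using assms by (simp add: tight_def)
  have pne: "c {v, x} \<noteq> c {y, z}" if "y \<in> A \<union> B" "z \<in> A \<union> B" "y \<noteq> z" for y z
    using p that doubleton_in_edges_iff[of y z "A \<union> B"] by blast
  have kne: "k \<noteq> c {y, z}" if "y \<in> A \<and> z \<in> A \<or> y \<in> B \<and> z \<in> B" "y \<noteq> z" for y z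
    using kA kB that doubleton_in_edges_iff[of y z A] doubleton_in_edges_iff[of y z B] by blast
  have neq: "v \<noteq> y" if "y \<in> A \<union> B" for y using that assms(2) by blast
  have neqAB: "a \<noteq> b" if "a \<in> A" "b \<in> B" for a b using that assms(3) by blast
  \<comment> \<open>In the triangle \<open>v\<close>, \<open>x\<close>, \<open>b\<close> the edge at
    \<open>x\<close> and \<open>b\<close> has colour \<open>k\<close>, which differs from the colour
    of \<open>{v, x}\<close>; the third edge must repeat one of the two.\<close>
  have vB: "c {v, b} = k \<or> c {v, b} = c {v, x}" if b: "b \<in> B" for b
    using no_rainbow_triangleD[OF nr, of v x b] k[OF x b] pne[of x b] x b neq[of x] neq[of b]
      neqAB[of x b] by auto
  show ?thesis
  proof (cases "\<forall>b\<in>B. c {v, b} = k")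
    case False
    then obtain b where b: "b \<in> B" "c {v, b} = c {v, x}" "c {v, x} \<noteq> k" using vB by metis
    have vA: "c {v, a} = k \<or> c {v, a} = c {v, x}" if a: "a \<in> A" for a
      using no_rainbow_triangleD[OF nr, of v a b] k[OF a b(1)] pne[of a b] a b neq[of a] neq[of b]
        neqAB[of a b] by auto
    \<comment> \<open>The edge \<open>{x, a}\<close> has neither of the two colours possible at
      \<open>v\<close>, so the two edges at \<open>v\<close> must agree. The same works inside
      \<open>B\<close> with \<open>b\<close> in place of \<open>x\<close>.\<close>
    have "c {v, a} = c {v, x}" if a: "a \<in> A" for a
      using no_rainbow_triangleD[OF nr, of v x a] vA[OF a] pne[of x a] kne[of x a] x a b neq[of x] neq[of a]
      by (cases "a = x") auto
    moreover have "c {v, b'} = c {v, x}" if b': "b' \<in> B" for b'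
      using no_rainbow_triangleD[OF nr, of v b b'] vB[OF b'] pne[of b b'] kne[of b b'] b' b neq[of b] neq[of b']
      by (cases "b' = b") auto
    ultimately show ?thesis by blast
  qed auto
qed

text \<open>Induction on the vertices: a cut of \<open>T\<close> extends to
  \<open>insert v T\<close>, since by \<open>tight_step\<close> the vertex \<open>v\<close> either
  joins one of the sides or forms a side alone.\<close>

lemma tight_imp_cut:
  assumes "tight c S" "card S \<ge> 2"
  shows "\<exists>A B k. S = A \<union> B \<and> A \<inter> B = {} \<and> A \<noteq> {} \<and> B \<noteq> {} \<and> (\<forall>a\<in>A. \<forall>b\<in>B. c {a, b} = k)"
proof -
  have "finite S" using assms by (simp add: tight_def)
  then show ?thesis using assms
  proof (induction S rule: finite_induct)
    case (insert v T)
    have "T \<noteq> {}" using insert by auto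
    then obtain p where T: "tight c T" and p: "p \<notin> c ` edges T"
      and cp: "c ` edges (insert v T) = insert p (c ` edges T)"
      using tight_insert insert by metis
    show ?case
    proof (cases "card T \<ge> 2")
      case False
      have "card T > 0" using \<open>T \<noteq> {}\<close> insert by (simp add: card_gt_0_iff)
      then have "card T = 1" using False by linarith
      then obtain w where "T = {w}" by (rule card_1_singletonE)
      then show ?thesis using insert.hyps
        by (intro exI[of _ "{v}"] exI[of _ "{w}"] exI[of _ "c {v, w}"]) auto
    next
      case True
      then obtain A B k where AB: "T = A \<union> B" "A \<inter> B = {}" "A \<noteq> {}" "B \<noteq> {}"
        and k: "\<And>a b. a \<in> A \<Longrightarrow> b \<in> B \<Longrightarrow> c {a, b} = k"
        using insert.IH T by blast
      note kAB = tight_cut(3,4)[OF T AB k]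
      obtain x where x: "x \<in> A \<union> B" "c {v, x} = p"
      proof -
        have "p \<in> c ` (edges T \<union> (\<lambda>x. {v, x}) ` T)"
          using cp unfolding edges_insert[OF insert.hyps(2)] by simp
        then show ?thesis using that p AB(1) by auto
      qed
      have ts: "tight c (insert v (A \<union> B))" and vT: "v \<notin> A \<union> B"
        and px: "c {v, x} \<notin> c ` edges (A \<union> B)"
        using insert.prems(1) insert.hyps(2) p x(2) AB(1) by simp_all
      \<comment> \<open>\<open>tight_step\<close> wants the edge of colour \<open>p\<close> to end
        in its first side, so the case \<open>x \<in> B\<close> uses it with the sides
        exchanged.\<close>
      have dich: "(\<forall>b\<in>B. c {v, b} = k) \<or> (\<forall>a\<in>A. c {v, a} = k) \<or> (\<forall>y\<in>T. c {v, y} = p)"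
      proof (cases "x \<in> A")
        case True
        have "(\<forall>b\<in>B. c {v, b} = k) \<or> (\<forall>y\<in>A \<union> B. c {v, y} = c {v, x})"
          using ts vT AB(2-4) k kAB True px by (rule tight_step)
        then show ?thesis using AB(1) x(2) by blast
      next
        case False
        have k': "c {b, a} = k" if "b \<in> B" "a \<in> A" for a b using k[OF that(2,1)] by (simp add: insert_commute)
        have "x \<in> B" using False x(1) by blast
        have "(\<forall>a\<in>A. c {v, a} = k) \<or> (\<forall>y\<in>B \<union> A. c {v, y} = c {v, x})"
          using ts[unfolded Un_commute[of A]] vT[unfolded Un_commute[of A]]
            AB(2)[unfolded Int_commute[of A]] AB(4,3) k' kAB(2,1) \<open>x \<in> B\<close>
            px[unfolded Un_commute[of A]]
          by (rule tight_step)
        then show ?thesis using AB(1) x(2) by blast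
      qed
      then consider "\<forall>b\<in>B. c {v, b} = k" | "\<forall>a\<in>A. c {v, a} = k" | "\<forall>y\<in>T. c {v, y} = p"
        by blast
      then show ?thesis
      proof cases
        case 1
        then show ?thesis using AB k insert.hyps
          by (intro exI[of _ "insert v A"] exI[of _ B] exI[of _ k]) auto
      next
        case 2
        then show ?thesis using AB k insert.hyps
          by (intro exI[of _ A] exI[of _ "insert v B"] exI[of _ k]) (auto simp: insert_commute)
      next
        case 3
        then show ?thesis using insert.hyps \<open>T \<noteq> {}\<close>
          by (intro exI[of _ "{v}"] exI[of _ T] exI[of _ p]) auto
      qed
    qed
  qed simp
qed

section \<open>Maximal Gallai partitions on arbitrary vertex sets\<close>

text \<open>The sides of a cut are arbitrary vertex sets, so the induction needs the notion beyond
  \<open>{1..n}\<close>.\<close>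

definition max_gallai :: "'a set \<Rightarrow> 'a set set set \<Rightarrow> bool" where
  "max_gallai S P \<longleftrightarrow>
     partition_on (edges S) P \<and> card P = card S - 1 \<and>
     (\<forall>vs. is_cycle (edges S) vs \<longrightarrow>
        (\<exists>B\<in>P. \<exists>e\<in>cycle_edges vs. \<exists>f\<in>cycle_edges vs. e \<noteq> f \<and> e \<in> B \<and> f \<in> B))"

lemma maximal_gallai_partition_iff: "maximal_gallai_partition n P \<longleftrightarrow> max_gallai {1..n} P"
  by (simp add: maximal_gallai_partition_def gallai_partition_def max_gallai_def
      complete_graph_edges_def)

lemma max_gallai_block:
  assumes "max_gallai S P" "X \<in> P"
  shows "X \<noteq> {}" "X \<subseteq> edges S"
  using assms by (auto simp: max_gallai_def partition_on_def)

lemma max_gallai_finite: "finite S \<Longrightarrow> max_gallai S P \<Longrightarrow> finite P"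
  unfolding max_gallai_def using finite_elements finite_edges by blast

lemma finite_max_gallai:
  assumes "finite S"
  shows "finite {P. max_gallai S P}"
proof (rule finite_subset)
  show "{P. max_gallai S P} \<subseteq> Pow (Pow (edges S))" using max_gallai_block(2) by blast
  show "finite (Pow (Pow (edges S)))" using assms by (simp add: finite_edges)
qed

lemma max_gallai_singleton: "max_gallai {v} P \<longleftrightarrow> P = {}"
proof -
  have "\<not> is_cycle {} vs" for vs :: "'a list"
    unfolding is_cycle_def cycle_edges_def by (cases vs) auto
  then show ?thesis by (auto simp: max_gallai_def partition_on_def)
qed

section \<open>From partitions to colourings: the block of an edge is its colour\<close>

definition block :: "'b set set \<Rightarrow> 'b \<Rightarrow> 'b set" where
  "block P e = (THE B. B \<in> P \<and> e \<in> B)"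

lemma block_eq:
  assumes "partition_on X P" "B \<in> P" "e \<in> B"
  shows "block P e = B"
  unfolding block_def
proof (rule the_equality)
  show "B' = B" if "B' \<in> P \<and> e \<in> B'" for B'
    using that assms partition_onD2[OF assms(1)] by (auto simp: disjoint_def)
qed (use assms in auto)

lemma block_mem:
  assumes "partition_on X P" "e \<in> X"
  shows "block P e \<in> P" "e \<in> block P e"
proof -
  obtain B where "B \<in> P" "e \<in> B" using assms partition_onD1 by blast
  then show "block P e \<in> P" "e \<in> block P e" using block_eq[OF assms(1)] by auto
qed

lemma block_image:
  assumes "partition_on X P"
  shows "block P ` X = P"
proof (intro equalityI subsetI)
  fix B assume B: "B \<in> P"
  then obtain e where e: "e \<in> B" using partition_onD3[OF assms] by (metis ex_in_conv)
  have "e \<in> X" using B e partition_onD1[OF assms] by blast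
  then show "B \<in> block P ` X" using block_eq[OF assms B e] by blast
qed (use block_mem(1)[OF assms] in blast)

lemma cycle_edges_triangle: "cycle_edges [x, y, z] = {{x, y}, {y, z}, {z, x}}"
proof -
  have "i < length [x, y, z] \<longleftrightarrow> i = 0 \<or> i = 1 \<or> i = 2" for i by auto
  then have "cycle_edges [x, y, z] =
      (\<lambda>i. {[x, y, z] ! i, [x, y, z] ! (Suc i mod length [x, y, z])}) ` {0, 1, 2}"
    unfolding cycle_edges_def by blast
  then show ?thesis by (simp add: numeral_2_eq_2)
qed

text \<open>Cycles of length three rule out rainbow triangles, and the colours that occur are
  exactly the blocks, of which there are \<open>card S - 1\<close>.\<close>

lemma max_gallai_tight:
  assumes "finite S" "max_gallai S P"
  shows "tight (block P) S"
proof -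
  have part: "partition_on (edges S) P" using assms(2) unfolding max_gallai_def by (rule conjunct1)
  have "no_rainbow_triangle (block P) S"
    unfolding no_rainbow_triangle_def
  proof (intro ballI impI)
    fix x y z assume xyz: "x \<in> S" "y \<in> S" "z \<in> S" "x \<noteq> y" "y \<noteq> z" "x \<noteq> z"
    then have "is_cycle (edges S) [x, y, z]"
      by (simp add: is_cycle_def cycle_edges_triangle)
    then obtain B e f where B: "B \<in> P" "e \<noteq> f" "e \<in> B" "f \<in> B"
      and "e \<in> cycle_edges [x, y, z]" "f \<in> cycle_edges [x, y, z]"
      using assms unfolding max_gallai_def by blast
    then have ef: "e \<in> {{x, y}, {y, z}, {x, z}}" "f \<in> {{x, y}, {y, z}, {x, z}}"
      unfolding cycle_edges_triangle insert_commute[of z x "{}"] by blast+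
    have "block P e = block P f" "e \<noteq> f"
      using B block_eq[OF part B(1,3)] block_eq[OF part B(1,4)] by auto
    then show "block P {x, y} = block P {y, z} \<or> block P {y, z} = block P {x, z} \<or>
        block P {x, y} = block P {x, z}"
      using ef by (elim insertE emptyE) auto
  qed
  then show ?thesis using assms block_image[OF part] by (simp add: tight_def max_gallai_def)
qed

text \<open>By \<open>sub\<close>, a block that meets \<open>edges A\<close> stays inside it, so
  these blocks partition \<open>edges A\<close>. Tightness supplies their number, and a block
  repeated on a cycle in \<open>A\<close> is one of them.\<close>

lemma max_gallai_restrict:
  assumes "max_gallai S P" "A \<subseteq> S" "tight (block P) A"
    and sub: "\<And>e. e \<in> edges A \<Longrightarrow> block P e \<subseteq> edges A"
  shows "max_gallai A (block P ` edges A)"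
  unfolding max_gallai_def
proof (intro conjI allI impI)
  have part: "partition_on (edges S) P" using assms(1) unfolding max_gallai_def by (rule conjunct1)
  have edges_sub: "edges A \<subseteq> edges S" using assms(2) by (rule nsets_mono)
  have inP: "block P ` edges A \<subseteq> P" using block_mem(1)[OF part] edges_sub by blast
  show "partition_on (edges A) (block P ` edges A)"
    unfolding partition_on_def
  proof (intro conjI)
    show "\<Union>(block P ` edges A) = edges A"
      using sub block_mem(2)[OF part] edges_sub by blast
    show "disjoint (block P ` edges A)"
      using partition_onD2[OF part] inP unfolding disjoint_def by blast
    show "{} \<notin> block P ` edges A" using partition_onD3[OF part] inP by blast
  qed
  show "card (block P ` edges A) = card A - 1" using assms(3) by (simp add: tight_def)
  fix vs assume cyc: "is_cycle (edges A) vs"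
  then have "is_cycle (edges S) vs" using edges_sub by (auto simp: is_cycle_def)
  then obtain B e f where B: "B \<in> P" "e \<in> cycle_edges vs" "f \<in> cycle_edges vs"
      "e \<noteq> f" "e \<in> B" "f \<in> B"
    using assms(1) unfolding max_gallai_def by blast
  have "e \<in> edges A" using cyc B by (auto simp: is_cycle_def)
  then have "B \<in> block P ` edges A" using block_eq[OF part] B by blast
  then show "\<exists>B\<in>block P ` edges A. \<exists>e\<in>cycle_edges vs. \<exists>f\<in>cycle_edges vs.
      e \<noteq> f \<and> e \<in> B \<and> f \<in> B"
    using B by blast
qed

text \<open>The colouring by blocks has a monochromatic cut, and by \<open>tight_cut\<close> the
  colours of the cut and of the two sides are all different. Hence the cut is a whole block and
  every other block lies within one side.\<close>

lemma max_gallai_decompose: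
  assumes "finite S" "card S \<ge> 2" "max_gallai S P"
  obtains A B PA PB where "S = A \<union> B" "A \<inter> B = {}" "A \<noteq> {}" "B \<noteq> {}"
    "max_gallai A PA" "max_gallai B PB" "P = insert (cut A B) (PA \<union> PB)"
proof -
  let ?c = "block P"
  have part: "partition_on (edges S) P" using assms(3) unfolding max_gallai_def by (rule conjunct1)
  have tight: "tight ?c S" using assms by (intro max_gallai_tight)
  obtain A B k where AB: "S = A \<union> B" "A \<inter> B = {}" "A \<noteq> {}" "B \<noteq> {}"
    and k: "\<And>a b. a \<in> A \<Longrightarrow> b \<in> B \<Longrightarrow> ?c {a, b} = k"
    using tight_imp_cut[OF tight assms(2)] by blast
  note t = tight_cut[OF tight AB k]
  have edges_S: "edges S = cut A B \<union> (edges A \<union> edges B)"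
    using edges_Un AB by simp
  have c_cut: "?c e = k" if "e \<in> cut A B" for e using that k by (auto simp: cut_def)
  have same: "f \<in> edges S" "?c f = ?c e" if "f \<in> ?c e" "e \<in> edges S" for e f
    using that block_mem[OF part that(2)] block_eq[OF part] partition_onD1[OF part] by blast+
  have subA: "?c e \<subseteq> edges A" if "e \<in> edges A" for e
  proof
    fix f assume "f \<in> ?c e"
    then have f: "f \<in> edges S" "?c f = ?c e" using same that edges_S by auto
    then have "?c f \<in> ?c ` edges A" using that by auto
    then have "f \<notin> cut A B" "f \<notin> edges B" using t(3,5) c_cut by blast+
    then show "f \<in> edges A" using f edges_S by blast
  qed
  have subB: "?c e \<subseteq> edges B" if "e \<in> edges B" for e
  proof
    fix f assume "f \<in> ?c e"
    then have f: "f \<in> edges S" "?c f = ?c e" using same that edges_S by auto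
    then have "?c f \<in> ?c ` edges B" using that by auto
    then have "f \<notin> cut A B" "f \<notin> edges A" using t(4,5) c_cut by blast+
    then show "f \<in> edges B" using f edges_S by blast
  qed
  obtain a b where ab: "a \<in> A" "b \<in> B" using AB by blast
  then have e0: "{a, b} \<in> cut A B" by (auto simp: cut_def)
  have "k = cut A B"
  proof (intro equalityI subsetI)
    fix f assume "f \<in> k"
    then have "f \<in> edges S" "?c f = k" using same[of f "{a, b}"] c_cut[OF e0] e0 edges_S by auto
    then show "f \<in> cut A B" using t(3,4) edges_S by blast
  next
    fix f assume "f \<in> cut A B"
    then show "f \<in> k" using block_mem(2)[OF part, of f] c_cut edges_S by auto
  qed
  moreover have "?c ` cut A B = {k}" using c_cut e0 by blast
  ultimately have P: "P = insert (cut A B) (?c ` edges A \<union> ?c ` edges B)"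
    using block_image[OF part] unfolding edges_S by (simp add: image_Un)
  have "A \<subseteq> S" "B \<subseteq> S" using AB(1) by auto
  show ?thesis
    by (rule that[OF AB max_gallai_restrict[OF assms(3) \<open>A \<subseteq> S\<close> t(1) subA]
          max_gallai_restrict[OF assms(3) \<open>B \<subseteq> S\<close> t(2) subB] P])
qed

section \<open>Cycles that cross a cut\<close>

lemma cyclic_switch:
  fixes Q :: "nat \<Rightarrow> bool"
  assumes "i < m" "j < m" "Q i" "\<not> Q j"
  shows "\<exists>l<m. Q l \<and> \<not> Q (Suc l mod m)"
proof (rule ccontr)
  assume "\<not> (\<exists>l<m. Q l \<and> \<not> Q (Suc l mod m))"
  then have step: "Q (Suc l mod m)" if "l < m" "Q l" for l
    using that by blast
  \<comment> \<open>If \<open>Q\<close> never switches off, it spreads from \<open>i\<close> around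
    the whole cycle.\<close>
  have "Q ((i + d) mod m)" for d
  proof (induction d)
    case 0
    then show ?case using assms by simp
  next
    case (Suc d)
    then have "Q (Suc ((i + d) mod m) mod m)" using assms by (intro step) auto
    then show ?case by (simp add: mod_Suc_eq)
  qed
  \<comment> \<open>This shift leads from \<open>i\<close> to \<open>j\<close> modulo
    \<open>m\<close>; adding \<open>m\<close> keeps the subtraction from truncating.\<close>
  from this[of "j + m - i"] show False using assms by simp
qed

text \<open>A closed walk that leaves \<open>A\<close> must also return to it, and both crossings
  are edges of the cut.\<close>

lemma cycle_crosses_cut_twice:
  assumes "3 \<le> length vs" "distinct vs" "set vs \<subseteq> A \<union> B" "A \<inter> B = {}"
    and "\<not> set vs \<subseteq> A" "\<not> set vs \<subseteq> B"
  shows "\<exists>e\<in>cycle_edges vs. \<exists>f\<in>cycle_edges vs. e \<noteq> f \<and> e \<in> cut A B \<and> f \<in> cut A B"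
proof -
  let ?m = "length vs"
  obtain x y where "x \<in> set vs" "x \<in> A" "y \<in> set vs" "y \<notin> A" using assms(3-6) by blast
  then obtain a b where ab: "a < ?m" "b < ?m" "vs ! a \<in> A" "vs ! b \<notin> A"
    unfolding in_set_conv_nth by blast
  obtain i where i: "i < ?m" "vs ! i \<in> A" "vs ! (Suc i mod ?m) \<notin> A"
    using cyclic_switch[of a ?m b "\<lambda>i. vs ! i \<in> A"] ab by blast
  obtain j where j: "j < ?m" "vs ! j \<notin> A" "vs ! (Suc j mod ?m) \<in> A"
    using cyclic_switch[of b ?m a "\<lambda>i. vs ! i \<notin> A"] ab by blast
  let ?si = "Suc i mod ?m" and ?sj = "Suc j mod ?m"
  have lt: "?si < ?m" "?sj < ?m" using i by (auto intro!: mod_less_divisor)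
  have B: "vs ! l \<in> B" if "l < ?m" "vs ! l \<notin> A" for l using that assms(3) nth_mem by blast
  have "{vs ! i, vs ! ?si} \<in> cut A B" "{vs ! j, vs ! ?sj} \<in> cut A B"
    using i j B lt by (auto simp: cut_def insert_commute)
  moreover have "{vs ! i, vs ! ?si} \<noteq> {vs ! j, vs ! ?sj}"
  proof
    assume "{vs ! i, vs ! ?si} = {vs ! j, vs ! ?sj}"
    then have "vs ! i = vs ! ?sj" "vs ! ?si = vs ! j"
      using i j by (auto simp: doubleton_eq_iff)
    \<comment> \<open>Two positions that are each other's successor occur only in a cycle of length
      at most 2.\<close>
    then have "i = ?sj" "?si = j" using nth_eq_iff_index_eq[OF assms(2)] i j lt by auto
    then show False using assms(1) i(1) j(1) by (auto simp: mod_Suc split: if_splits)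
  qed
  moreover have "{vs ! i, vs ! ?si} \<in> cycle_edges vs" "{vs ! j, vs ! ?sj} \<in> cycle_edges vs"
    using i j by (auto simp: cycle_edges_def)
  ultimately show ?thesis
    by (intro bexI[of _ "{vs ! i, vs ! ?si}"] bexI[of _ "{vs ! j, vs ! ?sj}"] conjI)
qed

lemma is_cycle_vertices:
  assumes "is_cycle (edges S) vs"
  shows "set vs \<subseteq> S"
proof
  fix v assume "v \<in> set vs"
  then obtain i where "i < length vs" "v = vs ! i" by (auto simp: in_set_conv_nth)
  then have "{v, vs ! (Suc i mod length vs)} \<in> edges S"
    using assms unfolding is_cycle_def cycle_edges_def by blast
  then show "v \<in> S" by (auto simp: nsets_def)
qed

lemma is_cycle_subset:
  assumes "is_cycle (edges S) vs" "set vs \<subseteq> A"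
  shows "is_cycle (edges A) vs"
proof -
  have "e \<in> edges A" if e: "e \<in> cycle_edges vs" for e
  proof -
    obtain i where i: "i < length vs" "e = {vs ! i, vs ! (Suc i mod length vs)}"
      using e by (auto simp: cycle_edges_def)
    then have "Suc i mod length vs < length vs" by (intro mod_less_divisor) auto
    then have "vs ! i \<in> A" "vs ! (Suc i mod length vs) \<in> A" using i(1) assms(2) nth_mem by blast+
    moreover have "e \<in> edges S" using assms e by (auto simp: is_cycle_def)
    ultimately show ?thesis using i(2) by simp
  qed
  then show ?thesis using assms by (auto simp: is_cycle_def)
qed

section \<open>Gluing partitions along a cut and recovering the pieces\<close>

lemma partition_on_Un:
  assumes "partition_on A P" "partition_on B Q" "A \<inter> B = {}"
  shows "partition_on (A \<union> B) (P \<union> Q)"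
  using assms disjoint_union[of P Q] by (auto simp: partition_on_def)

text \<open>A cycle within one side is handled by the partition of that side, and any other cycle
  meets the new block twice. The count is \<open>(card A - 1) + (card B - 1) + 1\<close>.\<close>

lemma max_gallai_compose:
  assumes fin: "finite A" "finite B" and AB: "A \<inter> B = {}" "A \<noteq> {}" "B \<noteq> {}"
    and PA: "max_gallai A PA" and PB: "max_gallai B PB"
  shows "max_gallai (A \<union> B) (insert (cut A B) (PA \<union> PB))"
  unfolding max_gallai_def
proof (intro conjI allI impI)
  let ?P = "insert (cut A B) (PA \<union> PB)"
  note blocks = max_gallai_block[OF PA] max_gallai_block[OF PB]
  note disj = cut_Int_edges[OF AB(1)]
  have cut_ne: "cut A B \<noteq> {}" using AB by (auto simp: cut_def)
  have partA: "partition_on (edges A) PA" and partB: "partition_on (edges B) PB"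
    using PA PB by (auto simp: max_gallai_def)
  have "partition_on (cut A B) {cut A B}" using cut_ne by (simp add: partition_on_space)
  moreover have "cut A B \<inter> (edges A \<union> edges B) = {}" using disj by blast
  ultimately have "partition_on (cut A B \<union> (edges A \<union> edges B)) ({cut A B} \<union> (PA \<union> PB))"
    by (intro partition_on_Un partA partB disj(3))
  then show "partition_on (edges (A \<union> B)) ?P"
    by (simp add: edges_Un[OF AB(1)])
  have "cut A B \<notin> PA \<union> PB" using blocks cut_ne disj by blast
  moreover have "PA \<inter> PB = {}" using blocks disj by blast
  moreover have "finite PA" "finite PB" using max_gallai_finite fin PA PB by blast+
  ultimately have "card ?P = Suc (card PA + card PB)" by (simp add: card_Un_disjoint)
  moreover have "card A > 0" "card B > 0" using fin AB by (auto simp: card_gt_0_iff)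
  ultimately show "card ?P = card (A \<union> B) - 1"
    using PA PB fin AB by (simp add: max_gallai_def card_Un_disjoint)
  fix vs assume cyc: "is_cycle (edges (A \<union> B)) vs"
  consider "set vs \<subseteq> A" | "set vs \<subseteq> B" | "\<not> set vs \<subseteq> A" "\<not> set vs \<subseteq> B" by blast
  then show "\<exists>B\<in>?P. \<exists>e\<in>cycle_edges vs. \<exists>f\<in>cycle_edges vs. e \<noteq> f \<and> e \<in> B \<and> f \<in> B"
  proof cases
    case 1
    then show ?thesis using is_cycle_subset[OF cyc] PA unfolding max_gallai_def by blast
  next
    case 2
    then show ?thesis using is_cycle_subset[OF cyc] PB unfolding max_gallai_def by blast
  next
    case 3
    then show ?thesis
      using cycle_crosses_cut_twice[of vs A B] cyc is_cycle_vertices[OF cyc] AB(1)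
      unfolding is_cycle_def by blast
  qed
qed

text \<open>The cut is recognised as the only block that touches every vertex.\<close>

lemma max_gallai_cut_unique:
  assumes "A \<union> B = A' \<union> B'" "A \<noteq> {}" "B \<noteq> {}" "A' \<inter> B' = {}" "A' \<noteq> {}" "B' \<noteq> {}"
    and "max_gallai A' PA'" "max_gallai B' PB'"
    and "cut A B \<in> insert (cut A' B') (PA' \<union> PB')"
  shows "cut A B = cut A' B'"
proof (rule ccontr)
  assume "cut A B \<noteq> cut A' B'"
  then have "cut A B \<subseteq> edges A' \<or> cut A B \<subseteq> edges B'"
    using assms(9) max_gallai_block(2)[OF assms(7)] max_gallai_block(2)[OF assms(8)] by auto
  then have "\<Union>(cut A B) \<subseteq> A' \<or> \<Union>(cut A B) \<subseteq> B'"
    using Union_edges_subset[of A'] Union_edges_subset[of B'] by (meson Union_mono order_trans)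
  then have "A' \<union> B' \<subseteq> A' \<or> A' \<union> B' \<subseteq> B'"
    unfolding Union_cut[OF assms(2,3)] assms(1) .
  then show False using assms(4-6) by blast
qed

text \<open>The far side is the neighbourhood of \<open>r\<close> in the cut, so the cut and a
  marked vertex determine which side is which.\<close>

lemma cut_side:
  assumes "A \<inter> B = {}" "r \<in> A"
  shows "{x. {r, x} \<in> cut A B} = B"
  using assms by (auto simp: cut_def doubleton_eq_iff)

text \<open>Blocks are nonempty, and the cut and the two sides have pairwise disjoint edge sets, so
  filtering by side recovers each piece.\<close>

lemma max_gallai_side:
  assumes "A \<inter> B = {}" "A \<noteq> {}" "B \<noteq> {}" "max_gallai A PA" "max_gallai B PB"
  shows "{X \<in> insert (cut A B) (PA \<union> PB). X \<subseteq> edges A} = PA"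
    "{X \<in> insert (cut A B) (PA \<union> PB). X \<subseteq> edges B} = PB"
proof -
  note disj = cut_Int_edges[OF assms(1)]
  have "cut A B \<noteq> {}" using assms(2,3) by (auto simp: cut_def)
  then have cut: "\<not> cut A B \<subseteq> edges A" "\<not> cut A B \<subseteq> edges B" using disj by auto
  have PA: "X \<subseteq> edges A" "\<not> X \<subseteq> edges B" if "X \<in> PA" for X
    using max_gallai_block[OF assms(4) that] disj(3) by auto
  have PB: "X \<subseteq> edges B" "\<not> X \<subseteq> edges A" if "X \<in> PB" for X
    using max_gallai_block[OF assms(5) that] disj(3) by auto
  show "{X \<in> insert (cut A B) (PA \<union> PB). X \<subseteq> edges A} = PA" using cut(1) PA(1) PB(2) by auto
  show "{X \<in> insert (cut A B) (PA \<union> PB). X \<subseteq> edges B} = PB" using cut(2) PB(1) PA(2) by auto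
qed

text \<open>Taking \<open>A\<close> to be the side that contains \<open>r\<close> turns the
  unordered pair of sides into an ordered one, so no partition is counted twice.\<close>

lemma bij_betw_max_gallai:
  assumes "finite S" "card S \<ge> 2" "r \<in> S"
  shows "bij_betw (\<lambda>(A, PA, PB). insert (cut A (S - A)) (PA \<union> PB))
    (SIGMA A:{A. r \<in> A \<and> A \<subset> S}. {P. max_gallai A P} \<times> {P. max_gallai (S - A) P})
    {P. max_gallai S P}"
    (is "bij_betw ?F ?X ?Y")
proof (rule bij_betw_imageI)
  show "inj_on ?F ?X"
  proof (rule inj_onI)
    fix t t' assume t: "t \<in> ?X" "t' \<in> ?X" "?F t = ?F t'"
    obtain A PA PB A' PA' PB' where tt: "t = (A, PA, PB)" "t' = (A', PA', PB')"
      by (metis prod_cases3)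
    have A: "r \<in> A" "A \<subset> S" and A': "r \<in> A'" "A' \<subset> S"
      and P: "max_gallai A PA" "max_gallai (S - A) PB"
      and P': "max_gallai A' PA'" "max_gallai (S - A') PB'"
      and eq: "insert (cut A (S - A)) (PA \<union> PB) = insert (cut A' (S - A')) (PA' \<union> PB')"
      using t unfolding tt by auto
    have "cut A (S - A) = cut A' (S - A')"
    proof (rule max_gallai_cut_unique)
      show "cut A (S - A) \<in> insert (cut A' (S - A')) (PA' \<union> PB')" using eq by blast
    qed (use A A' P' in auto)
    then have "S - A = S - A'"
      using cut_side[of A "S - A" r] cut_side[of A' "S - A'" r] A A' by auto
    then have AA: "A = A'" using A A' by blast
    have ne: "A \<inter> (S - A) = {}" "A \<noteq> {}" "S - A \<noteq> {}" using A by auto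
    note side = max_gallai_side[OF ne]
    have "PA = PA'" using side(1)[OF P] side(1)[OF P'[folded AA]] eq[folded AA] by simp
    moreover have "PB = PB'" using side(2)[OF P] side(2)[OF P'[folded AA]] eq[folded AA] by simp
    ultimately show "t = t'" using AA tt by blast
  qed
next
  show "?F ` ?X = ?Y"
  proof (intro equalityI subsetI)
    fix P assume "P \<in> ?F ` ?X"
    then obtain A PA PB where A: "r \<in> A" "A \<subset> S" "max_gallai A PA" "max_gallai (S - A) PB"
      and P: "P = insert (cut A (S - A)) (PA \<union> PB)" by auto
    have "max_gallai (A \<union> (S - A)) P"
      unfolding P using A assms(1) by (intro max_gallai_compose) (auto intro: finite_subset)
    moreover have "A \<union> (S - A) = S" using A by blast
    ultimately show "P \<in> ?Y" by simp
  next
    fix P assume "P \<in> ?Y"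
    then obtain A B PA PB where AB: "S = A \<union> B" "A \<inter> B = {}" "A \<noteq> {}" "B \<noteq> {}"
      "max_gallai A PA" "max_gallai B PB" "P = insert (cut A B) (PA \<union> PB)"
      using max_gallai_decompose[OF assms(1,2)] by blast
    \<comment> \<open>The decomposition does not tell which side contains \<open>r\<close>; the
      symmetry of the cut allows an exchange.\<close>
    have "cut B A = cut A B" by (auto simp: cut_def insert_commute)
    show "P \<in> ?F ` ?X"
    proof (cases "r \<in> A")
      case True
      have "S - A = B" using AB by blast
      then have "(A, PA, PB) \<in> ?X" "P = ?F (A, PA, PB)" using True AB by auto
      then show ?thesis by blast
    next
      case False
      have "S - B = A" using AB by blast
      then have "(B, PB, PA) \<in> ?X" "P = ?F (B, PB, PA)"
        using False AB assms(3) \<open>cut B A = cut A B\<close> by auto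
      then show ?thesis by blast
    qed
  qed
qed


section \<open>The recurrence for double factorials\<close>

lemma sum_psubsets_card:
  fixes f :: "nat \<Rightarrow> nat"
  assumes "finite T"
  shows "(\<Sum>C | C \<subset> T. f (card C)) = (\<Sum>i<card T. (card T choose i) * f i)"
proof -
  have fin: "finite {C. C \<subset> T}" using assms by (auto intro: finite_subset[of _ "Pow T"])
  have "(\<Sum>C | C \<subset> T. f (card C)) = (\<Sum>i<card T. \<Sum>C | C \<in> {C. C \<subset> T} \<and> card C = i. f (card C))"
    using fin assms by (intro sum.group[symmetric]) (auto intro: psubset_card_mono)
  also have "\<dots> = (\<Sum>i<card T. (card T choose i) * f i)"
  proof (rule sum.cong)
    fix i assume "i \<in> {..<card T}"
    \<comment> \<open>As \<open>i < card T\<close>, a subset of size \<open>i\<close> is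
      automatically proper.\<close>
    then have "{C. C \<in> {C. C \<subset> T} \<and> card C = i} = {C. C \<subseteq> T \<and> card C = i}" by auto
    then show "(\<Sum>C | C \<in> {C. C \<subset> T} \<and> card C = i. f (card C)) = (card T choose i) * f i"
      using n_subsets[OF assms, of i] by simp
  qed simp
  finally show ?thesis .
qed

lemma double_factorial_add_2: "double_factorial (m + 2) = (m + 2) * double_factorial m"
proof -
  have "{j \<in> {1..m + 2}. even j \<longleftrightarrow> even (m + 2)} = insert (m + 2) {j \<in> {1..m}. even j \<longleftrightarrow> even m}"
    by (auto simp: le_Suc_eq)
  then show ?thesis unfolding double_factorial_def by simp
qed

lemma double_factorial_step:
  assumes "n \<ge> 1"
  shows "double_factorial (2 * Suc n - 3) = (2 * n - 1) * double_factorial (2 * n - 3)"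
\<comment> \<open>For \<open>n = 1\<close> truncated subtraction gives \<open>2 * n - 3 = 0\<close>,
  and the empty product 1 stands for the usual value of (-1)!!.\<close>
proof (cases "n = 1")
  case True
  have "{j \<in> {1..1}. odd j} = {1::nat}" by auto
  then show ?thesis using True by (simp add: double_factorial_def)
next
  case False
  then have "2 * Suc n - 3 = (2 * n - 3) + 2" "2 * n - 1 = (2 * n - 3) + 2" using assms by auto
  then show ?thesis using double_factorial_add_2 by metis
qed

text \<open>
  With \<open>F\<close> the exponential generating function, \<open>(1 - 2 X) F' = 1 - F\<close>. Differentiating
  \<open>(1 - 2 X) u = (1 - F)\<^sup>2\<close> for \<open>u = F' (1 - F)\<close> yields \<open>u' = 0\<close>, so \<open>F' = 1 + F' F\<close>.
\<close>

lemma double_factorial_convolution: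
  assumes "n \<ge> 1"
  shows "double_factorial (2 * Suc n - 3) =
    (\<Sum>i<n. (n choose i) * (double_factorial (2 * Suc i - 3) * double_factorial (2 * (n - i) - 3)))"
proof -
  define a where "a n = double_factorial (2 * n - 3)" for n
  \<comment> \<open>The constant term is set to 0 by hand, because truncation makes
    \<open>a 0\<close> equal to 1.\<close>
  define F :: "real fps" where "F = Abs_fps (\<lambda>n. if n = 0 then 0 else real (a n) / fact n)"
  define u where "u = fps_deriv F * (1 - F)"
  have a1: "a 1 = 1" by (simp add: a_def double_factorial_def)
  have a_Suc: "real (a (Suc n)) = (2 * real n - 1) * real (a n)" if "n \<ge> 1" for n
    using double_factorial_step[OF that] that by (simp add: a_def of_nat_diff)
  have F0: "fps_nth F 0 = 0" by (simp add: F_def)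
  have dF: "fps_nth (fps_deriv F) n = real (a (Suc n)) / fact n" for n
    by (simp add: F_def field_simps del: of_nat_Suc)
  \<comment> \<open>Coefficientwise this is the recursion \<open>a_Suc\<close>, together with
    \<open>a 1 = 1\<close> at index 0.\<close>
  have ode: "(1 - 2 * fps_X) * fps_deriv F = 1 - F"
  proof (rule fps_ext)
    fix n
    show "fps_nth ((1 - 2 * fps_X) * fps_deriv F) n = fps_nth (1 - F) n"
    proof (cases n)
      case 0
      then show ?thesis using a1 F0 dF[of 0] by (simp add: algebra_simps)
    next
      case (Suc m)
      have "fps_nth ((1 - 2 * fps_X) * fps_deriv F) n =
          fps_nth (fps_deriv F) n - 2 * fps_nth (fps_deriv F) m"
        by (simp add: Suc left_diff_distrib mult.assoc numeral_fps_const del: fps_deriv_nth)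
      also have "\<dots> = real (a (Suc n)) / fact n - 2 * (real n * real (a n) / fact n)"
        unfolding dF using Suc by (simp del: of_nat_Suc)
      also have "\<dots> = - (real (a n) / fact n)"
      proof -
        have "real (a (Suc n)) = 2 * (real n * real (a n)) - real (a n)"
          using a_Suc[of n] Suc by (simp add: algebra_simps)
        then show ?thesis by (simp only: diff_divide_distrib times_divide_eq_right)
      qed
      finally show ?thesis using Suc by (simp add: F_def)
    qed
  qed
  have "(1 - F) ^ 2 = (1 - 2 * fps_X) * u"
    unfolding u_def by (metis ode mult.assoc power2_eq_square)
  then have "fps_deriv ((1 - F) ^ 2) = fps_deriv ((1 - 2 * fps_X) * u)" by simp
  \<comment> \<open>The left derivative is \<open>- 2 * u\<close>, which cancels the term from
    differentiating \<open>1 - 2 * fps_X\<close> on the right.\<close>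
  then have "(1 - 2 * fps_X) * fps_deriv u = 0"
    by (simp add: u_def power2_eq_square algebra_simps)
  moreover have "fps_nth (1 - 2 * fps_X :: real fps) 0 \<noteq> 0" by simp
  then have "(1 - 2 * fps_X :: real fps) \<noteq> 0" by fastforce
  ultimately have "fps_deriv u = 0" by simp
  then have "u = fps_const (fps_nth u 0)" by (simp add: fps_deriv_eq_0_iff)
  also have "fps_nth u 0 = 1" using F0 dF[of 0] a1 by (simp add: u_def)
  finally have "fps_deriv F = 1 + fps_deriv F * F" by (simp add: u_def algebra_simps)
  then have "fps_nth (fps_deriv F) n = fps_nth (fps_deriv F * F) n"
    using assms by (metis fps_add_nth fps_one_nth add_0 not_one_le_zero)
  also have "\<dots> = (\<Sum>i\<le>n. real (a (Suc i)) / fact i * fps_nth F (n - i))"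
    by (simp add: fps_mult_nth dF atLeast0AtMost del: fps_deriv_nth)
  \<comment> \<open>The term \<open>i = n\<close> vanishes with the constant term of
    \<open>F\<close>.\<close>
  also have "\<dots> = (\<Sum>i<n. real (a (Suc i)) / fact i * fps_nth F (n - i))"
    using F0 by (simp add: lessThan_Suc_atMost[symmetric])
  also have "\<dots> = (\<Sum>i<n. real (a (Suc i)) / fact i * (real (a (n - i)) / fact (n - i)))"
    by (intro sum.cong) (auto simp: F_def)
  finally have "real (a (Suc n)) =
      (\<Sum>i<n. fact n * (real (a (Suc i)) / fact i * (real (a (n - i)) / fact (n - i))))"
    unfolding dF by (simp add: field_simps sum_distrib_left)
  also have "\<dots> = (\<Sum>i<n. real ((n choose i) * (a (Suc i) * a (n - i))))"
    by (intro sum.cong) (auto simp: binomial_fact field_simps)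
  finally have "a (Suc n) = (\<Sum>i<n. (n choose i) * (a (Suc i) * a (n - i)))"
    by (simp flip: of_nat_sum of_nat_mult)
  then show ?thesis by (simp only: a_def)
qed

section \<open>Counting by strong induction on the number of vertices\<close>

lemma card_max_gallai:
  assumes "finite S" "S \<noteq> {}"
  shows "card {P. max_gallai S P} = double_factorial (2 * card S - 3)"
  using assms
proof (induction "card S" arbitrary: S rule: less_induct)
  case less
  obtain r where r: "r \<in> S" using less by blast
  show ?case
  proof (cases "card S = 1")
    case True
    then obtain v where "S = {v}" by (rule card_1_singletonE)
    then have "{P. max_gallai S P} = {{}}" using max_gallai_singleton[of v] by auto
    then show ?thesis using True by (simp add: double_factorial_def)
  next
    case False
    define T where "T = S - {r}"
    define n where "n = card T"
    let ?g = "\<lambda>m. double_factorial (2 * m - 3)"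
    have "card S > 0" using less by (simp add: card_gt_0_iff)
    then have card: "card S \<ge> 2" "card S = Suc n" "n \<ge> 1"
      using False r less.prems by (auto simp: n_def T_def)
    have T: "finite T" "r \<notin> T" "S = insert r T" using less r by (auto simp: T_def)
    have "{A. r \<in> A \<and> A \<subset> S} \<subseteq> Pow S" by blast
    then have fin: "finite {A. r \<in> A \<and> A \<subset> S}" using less.prems finite_subset by blast
    have "card {P. max_gallai S P} =
        card (SIGMA A:{A. r \<in> A \<and> A \<subset> S}. {P. max_gallai A P} \<times> {P. max_gallai (S - A) P})"
      by (rule bij_betw_same_card[OF bij_betw_max_gallai[OF less.prems(1) card(1) r], symmetric])
    also have "\<dots> =
        (\<Sum>A | r \<in> A \<and> A \<subset> S. card {P. max_gallai A P} * card {P. max_gallai (S - A) P})"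
      unfolding card_cartesian_product[symmetric]
    proof (intro card_SigmaI fin ballI finite_cartesian_product finite_max_gallai)
      show "finite A" if "A \<in> {A. r \<in> A \<and> A \<subset> S}" for A
        using that less.prems(1) finite_subset by blast
    qed (use less.prems(1) in simp)
    also have "\<dots> = (\<Sum>A | r \<in> A \<and> A \<subset> S. ?g (card A) * ?g (card (S - A)))"
    proof (intro sum.cong refl)
      fix A assume "A \<in> {A. r \<in> A \<and> A \<subset> S}"
      then have A: "A \<subset> S" "S - A \<subset> S" "A \<noteq> {}" "S - A \<noteq> {}" using r by auto
      then have "card A < card S" "card (S - A) < card S" "finite A" "finite (S - A)"
        using less.prems psubset_card_mono finite_subset by blast+
      then show "card {P. max_gallai A P} * card {P. max_gallai (S - A) P} =
          ?g (card A) * ?g (card (S - A))"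
        using less.hyps A by simp
    qed
    \<comment> \<open>Put \<open>C = A - {r}\<close>: it is a proper subset of \<open>T\<close>
      because \<open>A \<noteq> S\<close>, and the other side has \<open>n - card C\<close>
      vertices.\<close>
    also have "\<dots> = (\<Sum>C | C \<subset> T. ?g (Suc (card C)) * ?g (n - card C))"
    proof (rule sum.reindex_bij_witness[where i = "insert r" and j = "\<lambda>A. A - {r}"])
      fix A assume A: "A \<in> {A. r \<in> A \<and> A \<subset> S}"
      then have "finite A" using less.prems finite_subset by blast
      then have "card A = Suc (card (A - {r}))" using A by (metis card_Suc_Diff1 mem_Collect_eq)
      moreover have "card (S - A) = card S - card A" using A \<open>finite A\<close> by (intro card_Diff_subset) auto
      ultimately show "?g (Suc (card (A - {r}))) * ?g (n - card (A - {r})) =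
          ?g (card A) * ?g (card (S - A))"
        using card(2) by simp
    qed (use T in auto)
    also have "\<dots> = (\<Sum>i<n. (n choose i) * (?g (Suc i) * ?g (n - i)))"
      using sum_psubsets_card[OF T(1), of "\<lambda>i. ?g (Suc i) * ?g (n - i)"] unfolding n_def .
    also have "\<dots> = ?g (card S)"
      using double_factorial_convolution[OF card(3)] card(2) by simp
    finally show ?thesis .
  qed
qed

theorem theorem1p18:
  fixes n :: nat
  assumes "n > 1"
  shows "card {P. maximal_gallai_partition n P} = double_factorial (2 * n - 3)"
  using card_max_gallai[of "{1..n}"] assms by (simp add: maximal_gallai_partition_iff)

end
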